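(* Let $n\ge d\ge1$ and consider the case $m=k=1$ (so $s=1$ and the sketching matrix is an arbitrary row vector $w^T$, $w\in\mathbb R^n$). Let $\mathcal L_1=\{A\mapsto L_1^{\mathrm{SCW}}(w^T,A)\}_{w\in\mathbb R^n}$ as functions on $\mathcal A=\{A\in\mathbb R^{n\times d}:\|A\|_F=1\}$. Then $\mathrm{pdim}(\mathcal L_1)=\Theta(n)$, and for every $\epsilon\in(0,1/2)$, $\mathrm{fatdim}_\epsilon(\mathcal L_1)=\Theta(n)$ (with absolute constants in $\Theta$).
   Context: For a matrix $M$, $[M]_k$ denotes a best approximation of $M$ of rank at most $k$ in Frobenius norm. For $S\in\mathbb R^{m\times n}$ and $A\in\mathbb R^{n\times d}$, SCW outputs $\mathrm{SCW}_k(S,A)$: if $SA=0$ the zero matrix; otherwise, with a thin SVD $SA=U\Sigma V^T$, the matrix $[AV]_kV^T$. The SCW loss is $L_k^{\mathrm{SCW}}(S,A)=\|A-\mathrm{SCW}_k(S,A)\|_F$. A set $\{x_1,\dots,x_N\}$ is pseudo-shattered by a class $\mathcal L$ of real functions if there are thresholds $r_i$ such that for every $I\subseteq\{1,\dots,N\}$ some $L\in\mathcal L$ has $L(x_i)>r_i\iff i\in I$; it is $\gamma$-fat shattered if there are thresholds $r_i$ such that for every $I$ some $L\in\mathcal L$ has $L(x_i)>r_i+\gamma$ for $i\in I$ and $L(x_i)<r_i-\gamma$ for $i\notin I$. $\mathrm{pdim}$ and $\mathrm{fatdim}_\gamma$ are the maximum sizes of such sets. *)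

theory Defs
  imports Complex_Main "Jordan_Normal_Form.Matrix" "HOL-Library.Extended_Nat"
begin

definition frob :: "real mat \<Rightarrow> real" where
  "frob M = sqrt (\<Sum>i<dim_row M. \<Sum>j<dim_col M. (M $$ (i,j))^2)"

definition rank_le :: "real mat \<Rightarrow> nat \<Rightarrow> bool" where
  "rank_le M k \<longleftrightarrow> (\<exists>X Y. X \<in> carrier_mat (dim_row M) k \<and> Y \<in> carrier_mat k (dim_col M) \<and> M = X * Y)"

definition best_rank_approx :: "nat \<Rightarrow> real mat \<Rightarrow> real mat \<Rightarrow> bool" where
  "best_rank_approx k M B \<longleftrightarrow>
     B \<in> carrier_mat (dim_row M) (dim_col M) \<and> rank_le B k \<and>
     (\<forall>B'. B' \<in> carrier_mat (dim_row M) (dim_col M) \<longrightarrow> rank_le B' k \<longrightarrow> frob (M - B) \<le> frob (M - B'))"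

definition thin_svd :: "real mat \<Rightarrow> real mat \<Rightarrow> real mat \<Rightarrow> real mat \<Rightarrow> bool" where
  "thin_svd M U Sig V \<longleftrightarrow> (\<exists>r. U \<in> carrier_mat (dim_row M) r \<and> Sig \<in> carrier_mat r r \<and>
     V \<in> carrier_mat (dim_col M) r \<and> transpose_mat U * U = 1\<^sub>m r \<and> transpose_mat V * V = 1\<^sub>m r \<and>
     diagonal_mat Sig \<and> (\<forall>i<r. Sig $$ (i,i) > 0) \<and> M = U * Sig * transpose_mat V)"

definition SCW :: "nat \<Rightarrow> real mat \<Rightarrow> real mat \<Rightarrow> real mat" where
  "SCW k S A =
     (if S * A = 0\<^sub>m (dim_row S) (dim_col A) then 0\<^sub>m (dim_row A) (dim_col A)
      else (let V = (SOME V. \<exists>U Sig. thin_svd (S * A) U Sig V);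
                B = (SOME B. best_rank_approx k (A * V) B)
            in B * transpose_mat V))"

definition SCW_loss :: "nat \<Rightarrow> real mat \<Rightarrow> real mat \<Rightarrow> real" where
  "SCW_loss k S A = frob (A - SCW k S A)"

definition pseudo_shatters :: "('x \<Rightarrow> real) set \<Rightarrow> 'x set \<Rightarrow> bool" where
  "pseudo_shatters F P \<longleftrightarrow> (\<exists>r. \<forall>I \<subseteq> P. \<exists>f\<in>F. \<forall>x\<in>P. (f x > r x \<longleftrightarrow> x \<in> I))"

definition fat_shatters :: "real \<Rightarrow> ('x \<Rightarrow> real) set \<Rightarrow> 'x set \<Rightarrow> bool" where
  "fat_shatters \<gamma> F P \<longleftrightarrow> (\<exists>r. \<forall>I \<subseteq> P. \<exists>f\<in>F.
      (\<forall>x\<in>I. f x > r x + \<gamma>) \<and> (\<forall>x\<in>P - I. f x < r x - \<gamma>))"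

definition pdim :: "'x set \<Rightarrow> ('x \<Rightarrow> real) set \<Rightarrow> enat" where
  "pdim X F = Sup ((\<lambda>P. enat (card P)) ` {P. finite P \<and> P \<subseteq> X \<and> pseudo_shatters F P})"

definition fatdim :: "real \<Rightarrow> 'x set \<Rightarrow> ('x \<Rightarrow> real) set \<Rightarrow> enat" where
  "fatdim \<gamma> X F = Sup ((\<lambda>P. enat (card P)) ` {P. finite P \<and> P \<subseteq> X \<and> fat_shatters \<gamma> F P})"

definition unit_mats :: "nat \<Rightarrow> nat \<Rightarrow> real mat set" where
  "unit_mats n d = {A. A \<in> carrier_mat n d \<and> frob A = 1}"

definition L1_class :: "nat \<Rightarrow> (real mat \<Rightarrow> real) set" where
  "L1_class n = {(\<lambda>A. SCW_loss 1 (mat 1 n (\<lambda>(i,j). w $ j)) A) | w. w \<in> carrier_vec n}"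

end

theory Submission
  imports Defs "HOL-Library.FuncSet" "HOL-Analysis.Convex"
begin

text \<open>
  For \<open>|A| = 1\<close> and \<open>y = A\<^sup>T w\<close>, the loss is \<open>1\<close> if \<open>y = 0\<close> and \<open>sqrt (1 - |A y|\<^sup>2 / |y|\<^sup>2)\<close> otherwise.
  On the matrices \<open>e\<^sub>i e\<^sub>0\<^sup>T\<close> it is the indicator of \<open>w\<^sub>i = 0\<close>, which gives the lower bounds.

  If \<open>N\<close> matrices are shattered, comparing the loss with the thresholds amounts to reading the signs of
  \<open>N\<close> polynomials of degree 2 in \<open>n\<close> variables, which attain all \<open>2^N\<close> strict sign patterns. The
  products over subsets of these polynomials, evaluated at the \<open>2^N\<close> witnesses, form a matrix with the
  sign pattern of the Hadamard matrix, and its rank is at most the number \<open>D\<close> of monomials of degree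
  at most \<open>2 N\<close>. Forster's theorem on sign rank yields \<open>2^N \<le> 2 D\<^sup>2\<close>, and counting monomials turns
  this into \<open>N \<le> 21 n\<close>; this replaces the usual appeal to Warren's theorem.

  Forster's bound is proved by reweighting the points so that no point carries more than a
  \<open>2 D / 2^N\<close> fraction of the squared norm of the relevant functions. Such functions correlate well
  with their own sign vectors, whereas orthogonality of the sign vectors bounds the total correlation
  with a space of dimension \<open>D\<close>.
\<close>

subsection \<open>Linear combinations and orthonormal systems\<close>

text \<open>Agreement is demanded only on \<open>P\<close>. This covers functions on a finite set of
  points as well as, with \<open>P = UNIV\<close>, polynomial functions.\<close>

definition lin_comb :: "('b \<Rightarrow> 'a \<Rightarrow> real) \<Rightarrow> 'b set \<Rightarrow> 'a set \<Rightarrow> ('a \<Rightarrow> real) \<Rightarrow> bool" where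
  "lin_comb \<phi> B P f \<longleftrightarrow> (\<exists>c. \<forall>x\<in>P. f x = (\<Sum>b\<in>B. c b * \<phi> b x))"

lemma lin_combI: "(\<And>x. x \<in> P \<Longrightarrow> f x = (\<Sum>b\<in>B. c b * \<phi> b x)) \<Longrightarrow> lin_comb \<phi> B P f"
  unfolding lin_comb_def by blast

lemma lin_comb_zero: "(\<And>x. x \<in> P \<Longrightarrow> f x = 0) \<Longrightarrow> lin_comb \<phi> B P f"
  by (rule lin_combI[where c = "\<lambda>_. 0"]) simp

lemma lin_comb_add:
  assumes "lin_comb \<phi> B P f" "lin_comb \<phi> B P g"
  shows "lin_comb \<phi> B P (\<lambda>x. f x + g x)"
proof -
  from assms obtain c d where "\<forall>x\<in>P. f x = (\<Sum>b\<in>B. c b * \<phi> b x)"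
    and "\<forall>x\<in>P. g x = (\<Sum>b\<in>B. d b * \<phi> b x)" unfolding lin_comb_def by blast
  then show ?thesis
    by (intro lin_combI[where c = "\<lambda>b. c b + d b"]) (simp add: sum.distrib distrib_right)
qed

lemma lin_comb_cmult:
  assumes "lin_comb \<phi> B P f"
  shows "lin_comb \<phi> B P (\<lambda>x. a * f x)"
proof -
  from assms obtain c where "\<forall>x\<in>P. f x = (\<Sum>b\<in>B. c b * \<phi> b x)"
    unfolding lin_comb_def by blast
  then show ?thesis
    by (intro lin_combI[where c = "\<lambda>b. a * c b"]) (simp add: sum_distrib_left mult.assoc)
qed

lemma lin_comb_sum:
  assumes "\<And>i. i \<in> I \<Longrightarrow> lin_comb \<phi> B P (f i)"
  shows "lin_comb \<phi> B P (\<lambda>x. \<Sum>i\<in>I. f i x)"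
  using assms
  by (induction I rule: infinite_finite_induct) (auto intro: lin_comb_zero lin_comb_add)

lemma lin_comb_base:
  assumes "finite B" "b \<in> B"
  shows "lin_comb \<phi> B P (\<phi> b)"
proof (rule lin_combI[where c = "\<lambda>b'. if b' = b then 1 else 0"])
  fix x
  have "(\<Sum>b'\<in>B. (if b' = b then 1 else 0) * \<phi> b' x) = (\<Sum>b'\<in>B. if b' = b then \<phi> b' x else 0)"
    by (rule sum.cong) auto
  then show "\<phi> b x = (\<Sum>b'\<in>B. (if b' = b then 1 else 0) * \<phi> b' x)"
    using assms by (simp add: sum.delta)
qed

lemma lin_comb_trans:
  assumes "lin_comb \<phi> B P f" "\<And>b. b \<in> B \<Longrightarrow> lin_comb \<psi> C P (\<phi> b)"
  shows "lin_comb \<psi> C P f"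
proof -
  from assms(1) obtain c where c: "\<And>x. x \<in> P \<Longrightarrow> f x = (\<Sum>b\<in>B. c b * \<phi> b x)"
    unfolding lin_comb_def by blast
  have "lin_comb \<psi> C P (\<lambda>x. \<Sum>b\<in>B. c b * \<phi> b x)"
    by (intro lin_comb_sum lin_comb_cmult assms(2))
  then show ?thesis unfolding lin_comb_def using c by auto
qed

text \<open>Orthonormality for the inner product on functions on \<open>P\<close> with weights
  \<open>s\<close>. The weights are a parameter because the sign rank argument has to choose
  them.\<close>

definition orthonormal :: "'a set \<Rightarrow> ('a \<Rightarrow> real) \<Rightarrow> nat \<Rightarrow> (nat \<Rightarrow> 'a \<Rightarrow> real) \<Rightarrow> bool" where
  "orthonormal P s r e \<longleftrightarrow>
     (\<forall>k<r. \<forall>l<r. (\<Sum>x\<in>P. s x * e k x * e l x) = (if k = l then 1 else 0))"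

text \<open>Each new function loses its projection \<open>\<Sum>k<r. c k * e k x\<close>. If the
  residual \<open>g\<close> has norm zero, it vanishes on \<open>P\<close> because the weights are
  positive, and the system stays as it is; otherwise the normalised residual is appended. Dependent
  families thus give \<open>r < card B\<close>.\<close>

lemma gram_schmidt:
  fixes \<phi> :: "'b \<Rightarrow> 'a \<Rightarrow> real"
  assumes "finite P" "\<And>x. x \<in> P \<Longrightarrow> s x > 0" "finite B"
  shows "\<exists>r e. r \<le> card B \<and> orthonormal P s r e \<and> (\<forall>b\<in>B. lin_comb e {..<r} P (\<phi> b))"
  using \<open>finite B\<close>
proof induction
  case empty
  show ?case by (intro exI[of _ 0]) (simp add: orthonormal_def)
next
  case (insert b B)
  then obtain r e where r: "r \<le> card B" and e: "orthonormal P s r e"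
    and span: "\<forall>b\<in>B. lin_comb e {..<r} P (\<phi> b)" by blast
  define c where "c k = (\<Sum>x\<in>P. s x * \<phi> b x * e k x)" for k
  define g where "g x = \<phi> b x - (\<Sum>k<r. c k * e k x)" for x
  define q where "q = (\<Sum>x\<in>P. s x * g x * g x)"
  have orth: "(\<Sum>x\<in>P. s x * g x * e l x) = 0" if l: "l < r" for l
  proof -
    have "(\<Sum>x\<in>P. s x * g x * e l x)
        = c l - (\<Sum>x\<in>P. \<Sum>k<r. c k * (s x * e k x * e l x))"
      by (simp add: g_def c_def algebra_simps sum_subtractf sum_distrib_left)
    also have "(\<Sum>x\<in>P. \<Sum>k<r. c k * (s x * e k x * e l x))
        = (\<Sum>k<r. c k * (\<Sum>x\<in>P. s x * e k x * e l x))"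
      by (subst sum.swap) (simp add: sum_distrib_left)
    also have "\<dots> = (\<Sum>k<r. if k = l then c k else 0)"
      using e l by (intro sum.cong) (auto simp: orthonormal_def)
    also have "\<dots> = c l" using l by (simp add: sum.delta')
    finally show ?thesis by simp
  qed
  have q0: "q \<ge> 0" unfolding q_def
    using assms(2) by (intro sum_nonneg) (simp add: less_imp_le mult.assoc)
  show ?case
  proof (cases "q = 0")
    case True
    have "\<forall>x\<in>P. s x * g x * g x = 0"
      using True assms(1,2) unfolding q_def
      by (subst (asm) sum_nonneg_eq_0_iff) (auto simp: less_imp_le mult.assoc)
    then have "\<forall>x\<in>P. \<phi> b x = (\<Sum>k<r. c k * e k x)"
      using assms(2) by (force simp: g_def)
    then have "lin_comb e {..<r} P (\<phi> b)" by (auto intro: lin_combI)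
    with insert r e span show ?thesis by (intro exI[of _ r] exI[of _ e]) auto
  next
    case False
    with q0 have q: "q > 0" by simp
    define e' where "e' = e(r := (\<lambda>x. g x / sqrt q))"
    have e'_old: "e' k = e k" if "k < r" for k using that by (simp add: e'_def)
    have e'_new: "e' r = (\<lambda>x. g x / sqrt q)" by (simp add: e'_def)
    have new: "(\<Sum>x\<in>P. s x * e' r x * e' r x) = 1"
    proof -
      have "(\<Sum>x\<in>P. s x * e' r x * e' r x) = (\<Sum>x\<in>P. s x * g x * g x / q)"
        using q by (intro sum.cong) (auto simp: e'_new)
      also have "\<dots> = 1" using q by (simp add: q_def flip: sum_divide_distrib)
      finally show ?thesis .
    qed
    have mixed: "(\<Sum>x\<in>P. s x * e' r x * e' l x) = 0" if "l < r" for l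
    proof -
      have "(\<Sum>x\<in>P. s x * e' r x * e' l x) = (\<Sum>x\<in>P. s x * g x * e l x / sqrt q)"
        using that by (intro sum.cong) (auto simp: e'_new e'_old)
      then show ?thesis using orth[OF that] by (simp flip: sum_divide_distrib)
    qed
    have mixed': "(\<Sum>x\<in>P. s x * e' l x * e' r x) = 0" if "l < r" for l
      using mixed[OF that] by (simp add: ac_simps)
    have "orthonormal P s (Suc r) e'"
      unfolding orthonormal_def
    proof (intro allI impI)
      fix k l assume "k < Suc r" "l < Suc r"
      then consider "k < r" "l < r" | "k = r" "l = r" | "k = r" "l < r" | "k < r" "l = r"
        by linarith
      then show "(\<Sum>x\<in>P. s x * e' k x * e' l x) = (if k = l then 1 else 0)"
        by cases (use e new mixed mixed' in \<open>auto simp: orthonormal_def e'_old\<close>)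
    qed
    moreover have "lin_comb e' {..<Suc r} P (e k)" if "k < r" for k
      using lin_comb_base[of "{..<Suc r}" k e' P] that by (simp add: e'_old)
    then have old: "lin_comb e' {..<Suc r} P f" if "lin_comb e {..<r} P f" for f
      using that by (rule_tac lin_comb_trans[of e "{..<r}"]) auto
    have "lin_comb e' {..<Suc r} P (\<lambda>x. (\<Sum>k<r. c k * e k x) + sqrt q * e' r x)"
      by (intro lin_comb_add lin_comb_cmult lin_comb_base old) (auto simp: lin_comb_def)
    then have "lin_comb e' {..<Suc r} P (\<phi> b)"
      using q by (simp add: e'_new g_def)
    ultimately show ?thesis
      using insert r span old by (intro exI[of _ "Suc r"] exI[of _ e']) auto
  qed
qed

text \<open>Parseval's identity: in the expanded square only the diagonal terms survive.\<close>

lemma orthonormal_norm: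
  assumes "orthonormal P s r e" "\<And>x. x \<in> P \<Longrightarrow> f x = (\<Sum>k<r. c k * e k x)"
  shows "(\<Sum>x\<in>P. s x * (f x)\<^sup>2) = (\<Sum>k<r. (c k)\<^sup>2)"
proof -
  have "(\<Sum>x\<in>P. s x * (f x)\<^sup>2) = (\<Sum>x\<in>P. \<Sum>k<r. \<Sum>l<r. c k * c l * (s x * e k x * e l x))"
    using assms(2)
    by (intro sum.cong) (auto simp: power2_eq_square sum_product sum_distrib_left ac_simps)
  also have "\<dots> = (\<Sum>k<r. \<Sum>l<r. c k * c l * (\<Sum>x\<in>P. s x * e k x * e l x))"
    by (subst sum.swap, rule sum.cong, simp, subst sum.swap) (simp add: sum_distrib_left)
  also have "\<dots> = (\<Sum>k<r. \<Sum>l<r. if l = k then c k * c l else 0)"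
    using assms(1) by (intro sum.cong) (auto simp: orthonormal_def)
  also have "\<dots> = (\<Sum>k<r. (c k)\<^sup>2)" by (simp add: sum.delta power2_eq_square)
  finally show ?thesis .
qed

subsection \<open>Sign rank\<close>

text \<open>Cauchy-Schwarz on the coefficients, then Parseval. The sum of
  \<open>(e k x)\<^sup>2\<close> is the diagonal of the reproducing kernel; multiplied by
  \<open>s x\<close> it is the leverage of \<open>x\<close>.\<close>

lemma orthonormal_evaluation_bound:
  assumes "orthonormal P s r e" "lin_comb e {..<r} P f" "x \<in> P"
  shows "(f x)\<^sup>2 \<le> (\<Sum>y\<in>P. s y * (f y)\<^sup>2) * (\<Sum>k<r. (e k x)\<^sup>2)"
proof -
  obtain c where c: "\<And>y. y \<in> P \<Longrightarrow> f y = (\<Sum>k<r. c k * e k y)"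
    using assms(2) unfolding lin_comb_def by blast
  have "(f x)\<^sup>2 \<le> (\<Sum>k<r. (c k)\<^sup>2) * (\<Sum>k<r. (e k x)\<^sup>2)"
    using c[OF assms(3)] by (simp add: Cauchy_Schwarz_ineq_sum)
  then show ?thesis using orthonormal_norm[OF assms(1) c] by simp
qed

text \<open>The leverages are the diagonal of an orthogonal projection of rank \<open>r\<close>, so
  they add up to its trace.\<close>

lemma orthonormal_trace:
  assumes "orthonormal P s r e"
  shows "(\<Sum>x\<in>P. s x * (\<Sum>k<r. (e k x)\<^sup>2)) = real r"
proof -
  have "(\<Sum>x\<in>P. s x * (\<Sum>k<r. (e k x)\<^sup>2)) = (\<Sum>k<r. \<Sum>x\<in>P. s x * e k x * e k x)"
    by (simp add: sum_distrib_left power2_eq_square mult.assoc sum.swap[of _ _ P])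
  also have "\<dots> = (\<Sum>k<r. 1)" using assms by (intro sum.cong) (auto simp: orthonormal_def)
  finally show ?thesis by simp
qed

text \<open>Turns finitely many strict inequalities into one with a uniform margin.\<close>

lemma finite_gap:
  fixes a :: real
  assumes "finite X" "\<And>x. x \<in> X \<Longrightarrow> a < x"
  shows "\<exists>b>a. \<forall>x\<in>X. b < x"
  using assms
proof (induction X)
  case empty
  show ?case by (auto intro: exI[of _ "a + 1"])
next
  case (insert x X)
  then obtain b where "b > a" "\<forall>x\<in>X. b < x" by auto
  moreover from insert have "a < x" by simp
  then obtain c where "a < c" "c < x" using dense by blast
  ultimately show ?case by (intro exI[of _ "min b c"]) (auto simp: min_less_iff_disj)
qed

text \<open>Take \<open>s = 2\<^sup>-\<^sup>k\<close> with exponents \<open>k \<le> K\<close> of minimal sum such that the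
  leverage bound holds for the whole span at every point where \<open>k < K\<close>. If \<open>k x > 0\<close> then
  decreasing \<open>k x\<close> breaks the bound at \<open>x\<close> itself, as the bounds at all other points only get weaker.
  Since the leverages add up to at most the dimension, this cannot happen at all points, so some
  weight is \<open>1\<close>; for \<open>K\<close> large, this makes the bound for the finitely many \<open>f S\<close> trivial
  where \<open>k = K\<close>.\<close>
lemma flat_weights:
  fixes \<phi> :: "'b \<Rightarrow> 'a \<Rightarrow> real" and f :: "'s \<Rightarrow> 'a \<Rightarrow> real"
  assumes P: "finite P" "P \<noteq> {}" and B: "finite B" and T: "finite T" "T \<noteq> {}"
    and span: "\<And>S. S \<in> T \<Longrightarrow> lin_comb \<phi> B P (f S)"
    and nz: "\<And>S x. S \<in> T \<Longrightarrow> x \<in> P \<Longrightarrow> f S x \<noteq> 0"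
  obtains s where "\<And>x. x \<in> P \<Longrightarrow> s x > 0"
    "\<And>S x. S \<in> T \<Longrightarrow> x \<in> P \<Longrightarrow>
       real (card P) * (s x * (f S x)\<^sup>2) \<le> 2 * real (card B) * (\<Sum>y\<in>P. s y * (f S y)\<^sup>2)"
proof -
  define m where "m = real (card P)"
  define D where "D = real (card B)"
  have m: "m > 0" using P by (simp add: m_def card_gt_0_iff)
  have "B \<noteq> {}"
    using P T span nz unfolding lin_comb_def by fastforce
  then have D: "D > 0" using B by (simp add: D_def card_gt_0_iff)
  \<comment> \<open>\<open>\<eta>\<close> lies below every ratio for which a point \<open>x\<close>
    of weight \<open>(1/2) ^ K < \<eta>\<close> has to be compared with a point \<open>y\<close> of
    weight 1.\<close>
  have "\<exists>\<eta>>0. \<forall>z\<in>(\<lambda>(S,x,y). 2 * D * (f S y)\<^sup>2 / (m * (f S x)\<^sup>2)) ` (T \<times> P \<times> P). \<eta> < z"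
    using P(1) T(1) m D nz by (intro finite_gap) auto
  then obtain \<eta> where \<eta>: "\<eta> > 0"
    "\<And>S x y. S \<in> T \<Longrightarrow> x \<in> P \<Longrightarrow> y \<in> P \<Longrightarrow> \<eta> < 2 * D * (f S y)\<^sup>2 / (m * (f S x)\<^sup>2)"
    by force
  obtain K where K: "(1/2::real) ^ K < \<eta>"
    using real_arch_pow_inv[of \<eta> "1/2"] \<eta>(1) by auto
  define w :: "('a \<Rightarrow> nat) \<Rightarrow> 'a \<Rightarrow> real" where "w k x = (1/2) ^ k x" for k x
  have w_pos: "w k x > 0" for k x by (simp add: w_def)
  define flat where "flat k \<longleftrightarrow> (\<forall>x. k x \<le> K) \<and> (\<forall>x\<in>P. k x < K \<longrightarrow> (\<forall>g. lin_comb \<phi> B P g \<longrightarrow>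
     m * (w k x * (g x)\<^sup>2) \<le> 2 * D * (\<Sum>y\<in>P. w k y * (g y)\<^sup>2)))" for k
  \<comment> \<open>Vacuous, as no exponent is below \<open>K\<close>; it ensures that a minimal
    choice exists.\<close>
  have "flat (\<lambda>_. K)" by (simp add: flat_def)
  then obtain k where k: "flat k" and min: "\<And>k'. flat k' \<Longrightarrow> sum k P \<le> sum k' P"
    using ex_has_least_nat[of flat _ "\<lambda>k. sum k P"] by blast
  obtain r e where r: "r \<le> card B" and e: "orthonormal P (w k) r e"
    and espan: "\<And>b. b \<in> B \<Longrightarrow> lin_comb e {..<r} P (\<phi> b)"
    using gram_schmidt[of P "w k" B \<phi>] P B w_pos by blast
  have "\<exists>y\<in>P. k y = 0"
  proof (rule ccontr)
    assume contra: "\<not> (\<exists>y\<in>P. k y = 0)"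
    have "D < m * (w k x * (\<Sum>i<r. (e i x)\<^sup>2))" if x: "x \<in> P" for x
    proof -
      define k' where "k' = k(x := k x - 1)"
      have kx: "k x > 0" using contra x by auto
      have "sum k' P < sum k P"
        using P x kx by (intro sum_strict_mono_ex1) (auto simp: k'_def)
      then have "\<not> flat k'" using min by force
      moreover have "k' y \<le> K" for y
        using k by (auto simp: flat_def k'_def intro: le_trans[OF diff_le_self])
      ultimately obtain z g where z: "z \<in> P" "k' z < K" and g: "lin_comb \<phi> B P g"
        and viol: "2 * D * (\<Sum>y\<in>P. w k' y * (g y)\<^sup>2) < m * (w k' z * (g z)\<^sup>2)"
        by (auto simp: flat_def not_le)
      define G where "G = (\<Sum>y\<in>P. w k y * (g y)\<^sup>2)"
      have "w k y \<le> w k' y" for y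
        by (auto simp: w_def k'_def intro!: power_decreasing)
      then have "G \<le> (\<Sum>y\<in>P. w k' y * (g y)\<^sup>2)"
        unfolding G_def by (intro sum_mono mult_right_mono) auto
      then have viol': "2 * D * G < m * (w k' z * (g z)\<^sup>2)"
        using viol D by (smt (verit) mult_left_mono)
      have "z = x"
      proof (rule ccontr)
        assume "z \<noteq> x"
        then have "k' z = k z" by (simp add: k'_def)
        then have "m * (w k z * (g z)\<^sup>2) \<le> 2 * D * G"
          using k z g unfolding flat_def G_def by auto
        then show False using viol' \<open>k' z = k z\<close> by (simp add: w_def)
      qed
      have "w k' x = 2 * w k x"
        using kx by (cases "k x") (auto simp: w_def k'_def)
      \<comment> \<open>Doubling the weight at \<open>x\<close> uses up the factor 2 in
        \<open>flat\<close>. The leverage of \<open>x\<close> under the old weights therefore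
        exceeds \<open>D / m\<close>.\<close>
      with viol' \<open>z = x\<close> have 1: "D * G < m * (w k x * (g x)\<^sup>2)" by simp
      have "(g x)\<^sup>2 \<le> G * (\<Sum>i<r. (e i x)\<^sup>2)"
        unfolding G_def
        by (rule orthonormal_evaluation_bound[OF e lin_comb_trans[OF g espan] x])
      then have "m * (w k x * (g x)\<^sup>2) \<le> m * (w k x * (G * (\<Sum>i<r. (e i x)\<^sup>2)))"
        using m w_pos by (intro mult_left_mono) (auto simp: less_imp_le)
      with 1 have "D * G < (m * (w k x * (\<Sum>i<r. (e i x)\<^sup>2))) * G" by (simp add: ac_simps)
      moreover have "G \<ge> 0" unfolding G_def using w_pos by (intro sum_nonneg) (simp add: less_imp_le)
      ultimately show ?thesis by (rule mult_right_less_imp_less)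
    qed
    then have "(\<Sum>x\<in>P. D) < (\<Sum>x\<in>P. m * (w k x * (\<Sum>i<r. (e i x)\<^sup>2)))"
      using P by (intro sum_strict_mono) auto
    also have "\<dots> = m * real r"
      by (simp add: orthonormal_trace[OF e] flip: sum_distrib_left)
    finally have "D < real r" using m by (simp add: m_def)
    then show False using r by (simp add: D_def)
  qed
  then obtain y where y: "y \<in> P" "k y = 0" by blast
  have "m * (w k x * (f S x)\<^sup>2) \<le> 2 * D * (\<Sum>y\<in>P. w k y * (f S y)\<^sup>2)"
    if S: "S \<in> T" and x: "x \<in> P" for S x
  proof (cases "k x < K")
    case True
    then show ?thesis using k x span[OF S] by (auto simp: flat_def)
  next
    case False
    with k have "k x = K" by (auto simp: flat_def not_less intro: antisym)
    then have "w k x < 2 * D * (f S y)\<^sup>2 / (m * (f S x)\<^sup>2)"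
      using K \<eta>(2)[OF S x y(1)] by (simp add: w_def)
    then have "m * (w k x * (f S x)\<^sup>2) \<le> 2 * D * (w k y * (f S y)\<^sup>2)"
      using m nz[OF S x] y(2) by (simp add: w_def field_simps)
    also have "\<dots> \<le> 2 * D * (\<Sum>y\<in>P. w k y * (f S y)\<^sup>2)"
      using D P(1) y(1) w_pos by (intro mult_left_mono member_le_sum) (auto simp: less_imp_le)
    finally show ?thesis .
  qed
  then show thesis using that[of "w k"] w_pos by (simp add: m_def D_def)
qed

text \<open>\<open>\<chi>\<close> is a sign matrix with rows \<open>S\<close>, orthogonal columns
  \<open>x\<close>, and the sign pattern of \<open>f\<close>, whose rows lie in a space of dimension
  at most \<open>card B\<close>. The sum of all \<open>(a S k)\<^sup>2\<close> is counted in two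
  ways: every row contributes at least \<open>m / (2 * D)\<close>, every \<open>k\<close> exactly
  \<open>card T\<close>.\<close>

theorem forster_sign_rank:
  fixes \<phi> :: "'b \<Rightarrow> 'a \<Rightarrow> real" and f \<chi> :: "'s \<Rightarrow> 'a \<Rightarrow> real"
  assumes P: "finite P" "P \<noteq> {}" and B: "finite B" and T: "finite T" "T \<noteq> {}"
    and span: "\<And>S. S \<in> T \<Longrightarrow> lin_comb \<phi> B P (f S)"
    and sign: "\<And>S x. S \<in> T \<Longrightarrow> x \<in> P \<Longrightarrow> \<bar>\<chi> S x\<bar> = 1 \<and> \<chi> S x * f S x > 0"
    and orth: "\<And>x y. x \<in> P \<Longrightarrow> y \<in> P \<Longrightarrow>
      (\<Sum>S\<in>T. \<chi> S x * \<chi> S y) = (if x = y then real (card T) else 0)"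
  shows "real (card P) \<le> 2 * (real (card B))\<^sup>2"
proof -
  define m where "m = real (card P)"
  define D where "D = real (card B)"
  have nz: "f S x \<noteq> 0" if "S \<in> T" "x \<in> P" for S x using sign[OF that] by auto
  obtain s where s: "\<And>x. x \<in> P \<Longrightarrow> s x > 0"
    and flat: "\<And>S x. S \<in> T \<Longrightarrow> x \<in> P \<Longrightarrow>
       m * (s x * (f S x)\<^sup>2) \<le> 2 * D * (\<Sum>y\<in>P. s y * (f S y)\<^sup>2)"
    unfolding m_def D_def
    by (rule flat_weights[where f = f, OF P B T span nz]) (assumption | blast)+
  obtain r e where r: "r \<le> card B" and e: "orthonormal P s r e"
    and espan: "\<And>b. b \<in> B \<Longrightarrow> lin_comb e {..<r} P (\<phi> b)"
    using gram_schmidt[of P s B \<phi>] P B s by blast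
  \<comment> \<open>The coefficient along \<open>e k\<close> of the function
    \<open>\<chi> S x / sqrt (s x)\<close> in the weighted inner product.\<close>
  define a where "a S k = (\<Sum>x\<in>P. \<chi> S x * sqrt (s x) * e k x)" for S k
  have lower: "m \<le> 2 * D * (\<Sum>k<r. (a S k)\<^sup>2)" if S: "S \<in> T" for S
  proof -
    define G where "G = (\<Sum>x\<in>P. s x * (f S x)\<^sup>2)"
    define L where "L = (\<Sum>x\<in>P. sqrt (s x) * \<bar>f S x\<bar>)"
    have G: "G > 0" unfolding G_def using P s nz[OF S] by (intro sum_pos) auto
    obtain c where c: "\<And>x. x \<in> P \<Longrightarrow> f S x = (\<Sum>k<r. c k * e k x)"
      using lin_comb_trans[OF span[OF S] espan] unfolding lin_comb_def by blast
    \<comment> \<open>As the signs agree, the weighted l1 norm of \<open>f S\<close> is its inner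
      product with the function that has the coefficients \<open>a S k\<close>.\<close>
    have "L = (\<Sum>x\<in>P. \<chi> S x * sqrt (s x) * f S x)"
      unfolding L_def
    proof (rule sum.cong)
      fix x assume x: "x \<in> P"
      have "\<bar>f S x\<bar> = \<chi> S x * f S x" using sign[OF S x] by (metis abs_mult abs_of_pos mult_1)
      then show "sqrt (s x) * \<bar>f S x\<bar> = \<chi> S x * sqrt (s x) * f S x" by simp
    qed simp
    also have "\<dots> = (\<Sum>x\<in>P. \<Sum>k<r. c k * (\<chi> S x * sqrt (s x) * e k x))"
      using c by (intro sum.cong) (auto simp: sum_distrib_left ac_simps)
    also have "\<dots> = (\<Sum>k<r. c k * a S k)"
      unfolding a_def by (subst sum.swap) (simp add: sum_distrib_left)
    finally have "L\<^sup>2 \<le> (\<Sum>k<r. (c k)\<^sup>2) * (\<Sum>k<r. (a S k)\<^sup>2)"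
      by (simp add: Cauchy_Schwarz_ineq_sum)
    also have "(\<Sum>k<r. (c k)\<^sup>2) = G"
      using orthonormal_norm[OF e c] by (simp add: G_def)
    finally have upper: "L\<^sup>2 \<le> G * (\<Sum>k<r. (a S k)\<^sup>2)" .
    \<comment> \<open>The squared l2 norm is at most the sup norm times the l1 norm; flatness bounds
      the sup norm of \<open>sqrt (s x) * \<bar>f S x\<bar>\<close> by
      \<open>sqrt (2 * D * G / m)\<close>.\<close>
    have "sqrt m * G \<le> (\<Sum>x\<in>P. sqrt (2 * D * G) * (sqrt (s x) * \<bar>f S x\<bar>))"
      unfolding G_def sum_distrib_left[of "sqrt m"]
    proof (rule sum_mono, fold G_def)
      fix x assume x: "x \<in> P"
      have "sqrt (m * (s x * (f S x)\<^sup>2)) \<le> sqrt (2 * D * G)"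
        unfolding G_def by (rule real_sqrt_le_mono[OF flat[OF S x]])
      then have "sqrt m * (sqrt (s x) * \<bar>f S x\<bar>) \<le> sqrt (2 * D * G)"
        by (simp add: real_sqrt_mult)
      then have "sqrt m * (sqrt (s x) * \<bar>f S x\<bar>) * (sqrt (s x) * \<bar>f S x\<bar>)
          \<le> sqrt (2 * D * G) * (sqrt (s x) * \<bar>f S x\<bar>)"
        using s[OF x] by (intro mult_right_mono) auto
      moreover have "(sqrt (s x) * \<bar>f S x\<bar>) * (sqrt (s x) * \<bar>f S x\<bar>) = s x * (f S x)\<^sup>2"
        using s[OF x] by (simp add: power2_eq_square algebra_simps)
      ultimately show "sqrt m * (s x * (f S x)\<^sup>2) \<le> sqrt (2 * D * G) * (sqrt (s x) * \<bar>f S x\<bar>)"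
        by (simp add: mult.assoc)
    qed
    also have "\<dots> = sqrt (2 * D * G) * L" by (simp add: L_def sum_distrib_left)
    finally have "(sqrt m * G)\<^sup>2 \<le> (sqrt (2 * D * G) * L)\<^sup>2"
      using G by (intro power_mono) (auto simp: m_def)
    then have "m * G\<^sup>2 \<le> 2 * D * G * L\<^sup>2"
      using G by (simp add: power_mult_distrib m_def D_def)
    also have "\<dots> \<le> 2 * D * G * (G * (\<Sum>k<r. (a S k)\<^sup>2))"
      using G by (intro mult_left_mono upper) (auto simp: D_def)
    finally have "m * G\<^sup>2 \<le> (2 * D * (\<Sum>k<r. (a S k)\<^sup>2)) * G\<^sup>2"
      by (simp add: power2_eq_square ac_simps)
    then show ?thesis using G by simp
  qed
  have square: "(\<Sum>S\<in>T. (a S k)\<^sup>2) = real (card T)" if "k < r" for k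
  proof -
    define b where "b x = sqrt (s x) * e k x" for x
    have "(\<Sum>S\<in>T. (a S k)\<^sup>2) = (\<Sum>S\<in>T. \<Sum>x\<in>P. \<Sum>y\<in>P. b x * b y * (\<chi> S x * \<chi> S y))"
      by (simp add: a_def b_def power2_eq_square sum_product ac_simps)
    also have "\<dots> = (\<Sum>x\<in>P. \<Sum>y\<in>P. b x * b y * (\<Sum>S\<in>T. \<chi> S x * \<chi> S y))"
      by (subst sum.swap, rule sum.cong, simp, subst sum.swap) (simp add: sum_distrib_left)
    also have "\<dots> = (\<Sum>x\<in>P. \<Sum>y\<in>P. if y = x then real (card T) * (b x * b y) else 0)"
      by (intro sum.cong) (auto simp: orth)
    also have "\<dots> = real (card T) * (\<Sum>x\<in>P. b x * b x)"
      using P(1) by (simp add: sum.delta sum_distrib_left)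
    also have "(\<Sum>x\<in>P. b x * b x) = (\<Sum>x\<in>P. s x * e k x * e k x)"
      using s by (intro sum.cong) (auto simp: b_def less_imp_le)
    also have "\<dots> = 1" using e that by (simp add: orthonormal_def)
    finally show ?thesis by simp
  qed
  have "real (card T) * m = (\<Sum>S\<in>T. m)" by simp
  also have "\<dots> \<le> (\<Sum>S\<in>T. 2 * D * (\<Sum>k<r. (a S k)\<^sup>2))" by (intro sum_mono lower)
  also have "\<dots> = 2 * D * (\<Sum>k<r. \<Sum>S\<in>T. (a S k)\<^sup>2)"
    by (simp add: sum.swap[of _ T] flip: sum_distrib_left)
  also have "\<dots> = real (card T) * (2 * D * real r)" by (simp add: square)
  finally have "m \<le> 2 * D * real r" using T by (simp add: card_gt_0_iff)
  also have "\<dots> \<le> 2 * D\<^sup>2" using r by (simp add: D_def power2_eq_square mult_left_mono)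
  finally show ?thesis by (simp add: m_def D_def)
qed

subsection \<open>Sign patterns of polynomials\<close>

text \<open>Extensionality outside \<open>{..<n}\<close> gives each monomial a single exponent, so
  the cardinality counts monomials.\<close>

definition exponents :: "nat \<Rightarrow> nat \<Rightarrow> (nat \<Rightarrow> nat) set" where
  "exponents n M = {\<alpha> \<in> {..<n} \<rightarrow>\<^sub>E {..M}. (\<Sum>i<n. \<alpha> i) \<le> M}"

definition monom_at :: "nat \<Rightarrow> (nat \<Rightarrow> nat) \<Rightarrow> (nat \<Rightarrow> real) \<Rightarrow> real" where
  "monom_at n \<alpha> w = (\<Prod>i<n. w i ^ \<alpha> i)"

definition poly_fun :: "nat \<Rightarrow> nat \<Rightarrow> ((nat \<Rightarrow> real) \<Rightarrow> real) \<Rightarrow> bool" where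
  "poly_fun n M = lin_comb (monom_at n) (exponents n M) UNIV"

lemma finite_exponents [simp]: "finite (exponents n M)"
  unfolding exponents_def by (rule finite_subset[OF _ finite_PiE[of "{..<n}" "\<lambda>_. {..M}"]]) auto

text \<open>An exponent of total degree \<open>\<delta>\<close> gets the weight \<open>(9/10)^\<delta>\<close>: the sum of all weights is
  \<open>10^n\<close>, and those with \<open>\<delta> \<le> M\<close> weigh at least \<open>(9/10)^M\<close> each.\<close>
lemma card_exponents: "real (card (exponents n M)) * (9/10) ^ M \<le> 10 ^ n"
proof -
  have "real (card (exponents n M)) * (9/10) ^ M = (\<Sum>\<alpha>\<in>exponents n M. (9/10::real) ^ M)"
    by simp
  also have "\<dots> \<le> (\<Sum>\<alpha>\<in>exponents n M. \<Prod>i<n. (9/10) ^ \<alpha> i)"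
    by (intro sum_mono) (auto simp: exponents_def power_decreasing simp flip: power_sum)
  also have "\<dots> \<le> (\<Sum>\<alpha>\<in>{..<n} \<rightarrow>\<^sub>E {..M}. \<Prod>i<n. (9/10) ^ \<alpha> i)"
  proof (rule sum_mono2)
    show "finite ({..<n} \<rightarrow>\<^sub>E {..M})" by (simp add: finite_PiE)
    show "exponents n M \<subseteq> {..<n} \<rightarrow>\<^sub>E {..M}" unfolding exponents_def by (rule Collect_subset)
  qed (simp add: prod_nonneg)
  also have "\<dots> = (\<Prod>i<n. \<Sum>j\<le>M. (9/10) ^ j)"
    by (subst prod_sum_PiE) auto
  also have "\<dots> \<le> (\<Prod>i<n. 10)"
    by (intro prod_mono conjI sum_nonneg) (auto simp: lessThan_Suc_atMost[symmetric] geometric_sum simp del: sum.lessThan_Suc)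
  finally show ?thesis by simp
qed

text \<open>Here \<open>\<alpha>\<close> is arbitrary outside \<open>{..<n}\<close>: restricting it
  does not change the monomial. Sums of exponents can then be used directly.\<close>

lemma poly_fun_monom:
  assumes "(\<Sum>i<n. \<alpha> i) \<le> M"
  shows "poly_fun n M (monom_at n \<alpha>)"
proof -
  have "\<alpha> i \<le> M" if "i < n" for i
    using assms member_le_sum[of i "{..<n}" \<alpha>] that by simp
  then have "restrict \<alpha> {..<n} \<in> exponents n M"
    using assms by (auto simp: exponents_def)
  moreover have "monom_at n \<alpha> = monom_at n (restrict \<alpha> {..<n})"
    by (auto simp: monom_at_def intro!: prod.cong)
  ultimately show ?thesis
    unfolding poly_fun_def by (metis finite_exponents lin_comb_base)
qed

lemma poly_fun_mono:
  assumes "poly_fun n M f" "M \<le> M'"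
  shows "poly_fun n M' f"
  using assms(1) unfolding poly_fun_def
proof (rule lin_comb_trans)
  fix \<alpha> assume "\<alpha> \<in> exponents n M"
  then have "(\<Sum>i<n. \<alpha> i) \<le> M'" using assms(2) by (simp add: exponents_def)
  from poly_fun_monom[OF this]
  show "lin_comb (monom_at n) (exponents n M') UNIV (monom_at n \<alpha>)"
    by (simp add: poly_fun_def)
qed

lemma poly_fun_const: "poly_fun n M (\<lambda>_. a)"
proof -
  have "poly_fun n M (\<lambda>w. a * monom_at n (\<lambda>_. 0) w)"
    unfolding poly_fun_def
    by (intro lin_comb_cmult, fold poly_fun_def) (simp add: poly_fun_monom)
  then show ?thesis by (simp add: monom_at_def)
qed

lemma poly_fun_var:
  assumes "i < n"
  shows "poly_fun n 1 (\<lambda>w. w i)"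
proof -
  have "monom_at n (\<lambda>j. if j = i then 1 else 0) w = w i" for w
  proof -
    have "monom_at n (\<lambda>j. if j = i then 1 else 0) w = (\<Prod>j<n. if j = i then w j else 1)"
      unfolding monom_at_def by (rule prod.cong) auto
    then show ?thesis using assms by (simp add: prod.delta)
  qed
  then have "monom_at n (\<lambda>j. if j = i then 1 else 0) = (\<lambda>w. w i)" by (rule ext)
  then show ?thesis
    using poly_fun_monom[of "\<lambda>j. if j = i then 1 else 0" n 1] assms by (simp add: sum.delta)
qed

lemma poly_fun_add: "poly_fun n M f \<Longrightarrow> poly_fun n M g \<Longrightarrow> poly_fun n M (\<lambda>w. f w + g w)"
  unfolding poly_fun_def by (rule lin_comb_add)

lemma poly_fun_cmult: "poly_fun n M f \<Longrightarrow> poly_fun n M (\<lambda>w. a * f w)"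
  unfolding poly_fun_def by (rule lin_comb_cmult)

lemma poly_fun_diff:
  "poly_fun n M f \<Longrightarrow> poly_fun n M g \<Longrightarrow> poly_fun n M (\<lambda>w. f w - g w)"
  using poly_fun_add[OF _ poly_fun_cmult[of n M g "- 1"], of f] by simp

lemma poly_fun_sum: "(\<And>i. i \<in> I \<Longrightarrow> poly_fun n M (f i)) \<Longrightarrow> poly_fun n M (\<lambda>w. \<Sum>i\<in>I. f i w)"
  unfolding poly_fun_def by (rule lin_comb_sum)

lemma poly_fun_mult:
  assumes f: "poly_fun n M f" and g: "poly_fun n M' g"
  shows "poly_fun n (M + M') (\<lambda>w. f w * g w)"
proof -
  obtain c where c: "\<And>w. f w = (\<Sum>\<alpha>\<in>exponents n M. c \<alpha> * monom_at n \<alpha> w)"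
    using f unfolding poly_fun_def lin_comb_def by auto
  obtain d where d: "\<And>w. g w = (\<Sum>\<alpha>\<in>exponents n M'. d \<alpha> * monom_at n \<alpha> w)"
    using g unfolding poly_fun_def lin_comb_def by auto
  have "f w * g w = (\<Sum>\<alpha>\<in>exponents n M. \<Sum>\<beta>\<in>exponents n M'.
      (c \<alpha> * d \<beta>) * monom_at n (\<lambda>i. \<alpha> i + \<beta> i) w)" for w
    by (simp add: c d sum_product monom_at_def power_add prod.distrib ac_simps)
  moreover have "poly_fun n (M + M') (\<lambda>w. \<Sum>\<alpha>\<in>exponents n M. \<Sum>\<beta>\<in>exponents n M'.
      (c \<alpha> * d \<beta>) * monom_at n (\<lambda>i. \<alpha> i + \<beta> i) w)"
    by (intro poly_fun_sum poly_fun_cmult poly_fun_monom)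
      (auto simp: exponents_def sum.distrib intro: add_mono)
  ultimately show ?thesis by simp
qed

lemma poly_fun_prod:
  assumes "finite S" "\<And>i. i \<in> S \<Longrightarrow> poly_fun n M (f i)"
  shows "poly_fun n (M * card S) (\<lambda>w. \<Prod>i\<in>S. f i w)"
  using assms
proof (induction S)
  case empty
  show ?case by (simp add: poly_fun_const)
next
  case (insert x S)
  then show ?case using poly_fun_mult[of n M "f x" "M * card S"] by simp
qed

text \<open>These are Walsh characters. The product of the two signs at \<open>x\<close> is
  \<open>h x\<close>, and the sum over all \<open>S\<close> factors into the product of
  \<open>h x + 1\<close>, which has a zero factor wherever \<open>I\<close> and \<open>J\<close>
  differ.\<close>

lemma character_orthogonality:
  assumes "finite P" "I \<subseteq> P" "J \<subseteq> P"
  shows "(\<Sum>S\<in>Pow P. (\<Prod>x\<in>S. if x \<in> I then 1 else - 1) * (\<Prod>x\<in>S. if x \<in> J then 1 else - 1))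
    = (if I = J then real (card (Pow P)) else 0)"
proof -
  define h where "h x = (if x \<in> I \<longleftrightarrow> x \<in> J then 1 else - 1 :: real)" for x
  have "(\<Sum>S\<in>Pow P. (\<Prod>x\<in>S. if x \<in> I then 1 else - 1) * (\<Prod>x\<in>S. if x \<in> J then 1 else - 1))
    = (\<Sum>S\<in>Pow P. \<Prod>x\<in>S. h x)"
    unfolding prod.distrib[symmetric] h_def by (intro sum.cong prod.cong) auto
  also have "\<dots> = (\<Prod>x\<in>P. h x + 1)"
    using prod_add[OF assms(1), of h "\<lambda>_. 1"] by simp
  also have "\<dots> = (if I = J then real (card (Pow P)) else 0)"
  proof (cases "I = J")
    case True
    then show ?thesis using assms(1) by (simp add: h_def card_Pow)
  next
    case False
    then obtain x where "x \<in> P" "(x \<in> I) \<noteq> (x \<in> J)" using assms(2,3) by blast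
    then have "x \<in> P" "h x = - 1" by (auto simp: h_def)
    then have "(\<Prod>x\<in>P. h x + 1) = 0" using assms(1) by (intro prod_zero) force+
    then show ?thesis using False by simp
  qed
  finally show ?thesis .
qed

theorem quadratic_sign_shattering:
  fixes p :: "'x \<Rightarrow> (nat \<Rightarrow> real) \<Rightarrow> real"
  assumes P: "finite P" and p: "\<And>x. x \<in> P \<Longrightarrow> poly_fun n 2 (p x)"
    and pos: "\<And>I x. I \<subseteq> P \<Longrightarrow> x \<in> I \<Longrightarrow> p x (w I) > 0"
    and neg: "\<And>I x. I \<subseteq> P \<Longrightarrow> x \<in> P - I \<Longrightarrow> p x (w I) < 0"
    and n: "n \<ge> 1"
  shows "card P \<le> 21 * n"
proof -
  define N where "N = card P"
  define D where "D = card (exponents n (2 * N))"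
  define \<chi> where "\<chi> S I = (\<Prod>x\<in>S. if x \<in> I then 1 else - 1 :: real)" for S I :: "'x set"
  define f where "f S I = (\<Prod>x\<in>S. p x (w I))" for S I
  have "real (card (Pow P)) \<le> 2 * (real (card (exponents n (2 * N))))\<^sup>2"
  \<comment> \<open>Rows are the subsets \<open>S\<close> whose polynomials are multiplied, columns
    the patterns \<open>I\<close> with their witnesses \<open>w I\<close>; both range over
    \<open>Pow P\<close>.\<close>
  proof (rule forster_sign_rank[where \<chi> = \<chi> and f = f and T = "Pow P"
        and \<phi> = "\<lambda>\<alpha> I. monom_at n \<alpha> (w I)"])
    fix S assume S: "S \<in> Pow P"
    then have "finite S" using P by (auto intro: finite_subset)
    have "poly_fun n (2 * card S) (\<lambda>v. \<Prod>x\<in>S. p x v)"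
      using S p \<open>finite S\<close> by (intro poly_fun_prod) auto
    then have "poly_fun n (2 * N) (\<lambda>v. \<Prod>x\<in>S. p x v)"
      by (rule poly_fun_mono) (use S P in \<open>simp add: N_def card_mono\<close>)
    then obtain c where
      "\<And>v. (\<Prod>x\<in>S. p x v) = (\<Sum>\<alpha>\<in>exponents n (2 * N). c \<alpha> * monom_at n \<alpha> v)"
      unfolding poly_fun_def lin_comb_def by auto
    then show "lin_comb (\<lambda>\<alpha> I. monom_at n \<alpha> (w I)) (exponents n (2 * N)) (Pow P) (f S)"
      by (intro lin_combI) (simp add: f_def)
    fix I assume I: "I \<in> Pow P"
    have "\<bar>\<chi> S I\<bar> = 1" by (auto simp: \<chi>_def abs_prod intro: prod.neutral)
    moreover have "\<chi> S I * f S I > 0"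
      unfolding \<chi>_def f_def prod.distrib[symmetric]
      using S I pos neg by (intro prod_pos) auto
    ultimately show "\<bar>\<chi> S I\<bar> = 1 \<and> \<chi> S I * f S I > 0" ..
  next
    fix I J assume "I \<in> Pow P" "J \<in> Pow P"
    then show "(\<Sum>S\<in>Pow P. \<chi> S I * \<chi> S J) = (if I = J then real (card (Pow P)) else 0)"
      unfolding \<chi>_def using P by (intro character_orthogonality) auto
  qed (use P in auto)
  then have "2 ^ N \<le> 2 * (real D)\<^sup>2" using P by (simp add: card_Pow N_def D_def)
  \<comment> \<open>The factor turns \<open>D\<^sup>2\<close> into the square of the quantity that
    \<open>card_exponents\<close> bounds by \<open>10 ^ n\<close>.\<close>
  then have "2 ^ N * ((9/10) ^ (2 * N))\<^sup>2 \<le> 2 * (real D)\<^sup>2 * ((9/10) ^ (2 * N))\<^sup>2"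
    by (intro mult_right_mono) auto
  also have "\<dots> = 2 * (real D * (9/10) ^ (2 * N))\<^sup>2" by (simp add: power_mult_distrib)
  also have "\<dots> \<le> 2 * (10 ^ n)\<^sup>2"
    using card_exponents[of n "2 * N"] unfolding D_def
    by (intro mult_left_mono power_mono) auto
  also have "\<dots> = 2 * 100 ^ n" by (simp flip: power_mult power_mult_distrib add: power2_eq_square)
  also have "\<dots> \<le> 2 ^ n * 100 ^ n"
    using n self_le_power[of "2::real" n] by (intro mult_right_mono) auto
  also have "\<dots> = 200 ^ n" by (simp flip: power_mult_distrib)
  \<comment> \<open>The constant 21 is the least exponent for which the power of 13/10 reaches
    200.\<close>
  also have "\<dots> \<le> ((13/10) ^ 21) ^ n"
    by (rule power_mono) (simp_all add: power_divide)
  also have "\<dots> = (13/10) ^ (21 * n)" by (rule power_mult[symmetric])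
  finally have "2 ^ N * ((9/10) ^ (2 * N))\<^sup>2 \<le> (13/10::real) ^ (21 * n)" .
  \<comment> \<open>\<open>2 * (9/10) ^ 4 = 1.3122\<close>, so the left side still grows
    exponentially in \<open>N\<close>.\<close>
  moreover have "(13/10) ^ N \<le> 2 ^ N * ((9/10::real) ^ (2 * N))\<^sup>2"
  proof -
    have "2 * N * 2 = 4 * N" by simp
    then have "((9/10::real) ^ (2 * N))\<^sup>2 = ((9/10) ^ 4) ^ N" by (metis power_mult)
    then have "2 ^ N * ((9/10::real) ^ (2 * N))\<^sup>2 = (2 * (9/10) ^ 4) ^ N"
      by (simp only: power_mult_distrib)
    moreover have "(13/10) ^ N \<le> (2 * (9/10::real) ^ 4) ^ N"
      by (rule power_mono) (simp_all add: power_divide)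
    ultimately show ?thesis by simp
  qed
  ultimately have "(13/10::real) ^ N \<le> (13/10) ^ (21 * n)" by linarith
  moreover have "(1::real) < 13/10" by simp
  ultimately have "N \<le> 21 * n" using power_le_imp_le_exp by blast
  then show ?thesis by (simp only: N_def)
qed

subsection \<open>The loss of a row sketch\<close>

text \<open>The definition of \<open>SCW\<close> picks an arbitrary thin SVD, so every one must be
  understood. Two orthonormal columns do not fit into a single row, and \<open>M\<close> is nonzero,
  hence \<open>r = 1\<close>; \<open>t\<close> is the entry of \<open>U * Sig\<close> and may be
  negative.\<close>

lemma thin_svd_row:
  assumes M: "M \<in> carrier_mat 1 d" "M \<noteq> 0\<^sub>m 1 d" and svd: "thin_svd M U Sig V"
  obtains t where "V \<in> carrier_mat d 1" "(\<Sum>j<d. (V $$ (j,0))\<^sup>2) = 1"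
    "\<And>j. j < d \<Longrightarrow> M $$ (0,j) = t * V $$ (j,0)"
proof -
  from svd M(1) obtain r where U: "U \<in> carrier_mat 1 r" and Sig: "Sig \<in> carrier_mat r r"
    and V: "V \<in> carrier_mat d r" and UU: "transpose_mat U * U = 1\<^sub>m r"
    and VV: "transpose_mat V * V = 1\<^sub>m r" and dec: "M = U * Sig * transpose_mat V"
    unfolding thin_svd_def by auto
  have ent: "U $$ (0,i) * U $$ (0,j) = (if i = j then 1 else 0)" if "i < r" "j < r" for i j
    using arg_cong[OF UU, of "\<lambda>X. X $$ (i,j)"] that U by (simp add: scalar_prod_def)
  have "r \<le> 1"
  proof (rule ccontr)
    assume "\<not> r \<le> 1"
    then show False using ent[of 0 0] ent[of 1 1] ent[of 0 1] by auto
  qed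
  moreover have "r \<noteq> 0"
  proof
    assume "r = 0"
    then have "M = 0\<^sub>m 1 d" unfolding dec using U Sig V by (intro eq_matI) (auto simp: scalar_prod_def)
    then show False using M(2) by simp
  qed
  ultimately have r: "r = 1" by simp
  have "(\<Sum>j<d. (V $$ (j,0))\<^sup>2) = 1"
    using arg_cong[OF VV, of "\<lambda>X. X $$ (0,0)"] V r
    by (simp add: scalar_prod_def power2_eq_square atLeast0LessThan)
  moreover have "M $$ (0,j) = (U * Sig) $$ (0,0) * V $$ (j,0)" if "j < d" for j
    unfolding dec using that U Sig V r by (simp add: scalar_prod_def)
  ultimately show thesis using that V r by blast
qed

lemma thin_svd_row_exists:
  assumes M: "M \<in> carrier_mat 1 d" "M \<noteq> 0\<^sub>m 1 d"
  shows "\<exists>U Sig V. thin_svd M U Sig V"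
proof -
  define q where "q = (\<Sum>j<d. (M $$ (0,j))\<^sup>2)"
  obtain j where "j < d" "M $$ (0,j) \<noteq> 0"
  proof -
    have "\<exists>j<d. M $$ (0,j) \<noteq> 0"
    proof (rule ccontr)
      assume "\<not> ?thesis"
      then have "M = 0\<^sub>m 1 d" using M(1) by (intro eq_matI) auto
      then show False using M(2) by simp
    qed
    then show thesis using that by blast
  qed
  then have q: "q > 0" unfolding q_def by (intro sum_pos2[of _ j]) auto
  define V where "V = mat d 1 (\<lambda>(j,_). M $$ (0,j) / sqrt q)"
  define Sig where "Sig = mat 1 1 (\<lambda>_. sqrt q)"
  have "transpose_mat V * V = 1\<^sub>m 1"
  proof (rule eq_matI)
    fix i j assume "i < dim_row (1\<^sub>m 1 :: real mat)" "j < dim_col (1\<^sub>m 1 :: real mat)"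
    then have "(transpose_mat V * V) $$ (i,j) = (\<Sum>j<d. (M $$ (0,j) / sqrt q)\<^sup>2)"
      by (simp add: V_def scalar_prod_def power2_eq_square atLeast0LessThan)
    also have "\<dots> = q / q" using q
      by (simp add: power_divide q_def flip: sum_divide_distrib)
    finally show "(transpose_mat V * V) $$ (i,j) = 1\<^sub>m 1 $$ (i,j)"
      using q \<open>i < _\<close> \<open>j < _\<close> by simp
  qed (auto simp: V_def)
  moreover have "M = 1\<^sub>m 1 * Sig * transpose_mat V"
    using M(1) q by (intro eq_matI) (auto simp: V_def Sig_def scalar_prod_def)
  ultimately have "thin_svd M (1\<^sub>m 1) Sig V"
    unfolding thin_svd_def
  proof (intro exI[of _ 1] conjI)
    show "V \<in> carrier_mat (dim_col M) 1" using M(1) by (auto simp: V_def)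
  qed (use M(1) q in \<open>auto simp: Sig_def diagonal_mat_def\<close>)
  then show ?thesis by blast
qed

section \<open>Approximation of a matrix that already has low rank\<close>

lemma frob_eq_0:
  assumes "frob M = 0" "i < dim_row M" "j < dim_col M"
  shows "M $$ (i,j) = 0"
proof -
  have "(\<Sum>i<dim_row M. \<Sum>j<dim_col M. (M $$ (i,j))\<^sup>2) = 0"
    using assms(1) by (simp add: frob_def)
  then have "\<forall>i<dim_row M. (\<Sum>j<dim_col M. (M $$ (i,j))\<^sup>2) = 0"
    by (subst (asm) sum_nonneg_eq_0_iff) (auto intro: sum_nonneg)
  then show ?thesis using assms(2,3) by (simp add: sum_nonneg_eq_0_iff)
qed

lemma frob_nonneg: "frob M \<ge> 0"
  by (simp add: frob_def sum_nonneg)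

text \<open>The error 0 is attainable, so the optimum is unique and the choice operator in
  \<open>SCW\<close> is determined.\<close>

lemma best_rank_approx_self:
  assumes "rank_le M k" "best_rank_approx k M B"
  shows "B = M"
proof -
  have B: "B \<in> carrier_mat (dim_row M) (dim_col M)"
    and le: "frob (M - B) \<le> frob (M - M)"
    using assms unfolding best_rank_approx_def by auto
  have "frob (M - M) = 0" by (simp add: frob_def)
  with le have "frob (M - B) = 0" using frob_nonneg[of "M - B"] by simp
  then show ?thesis using frob_eq_0[of "M - B"] B by (intro eq_matI) auto
qed

lemma best_rank_approx_selfI: "rank_le M k \<Longrightarrow> best_rank_approx k M M"
proof -
  assume "rank_le M k"
  moreover have "frob (M - M) = 0" by (simp add: frob_def)
  ultimately show ?thesis by (simp add: best_rank_approx_def frob_nonneg)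
qed

text \<open>For a row sketch \<open>A * V\<close> has one column, so truncation to rank 1 leaves it
  unchanged.\<close>

lemma rank_le_one_col:
  assumes "M \<in> carrier_mat n 1"
  shows "rank_le M 1"
  unfolding rank_le_def
  by (rule exI[of _ M], rule exI[of _ "1\<^sub>m 1"]) (use assms in auto)

text \<open>The coordinates of \<open>A\<^sup>T w\<close>. The next two definitions are the
  quadratic forms \<open>|A\<^sup>T w|\<^sup>2\<close> and \<open>|A A\<^sup>T w|\<^sup>2\<close> in
  \<open>w\<close>, which is a function so that \<open>poly_fun\<close> applies.\<close>

definition row_image :: "real mat \<Rightarrow> (nat \<Rightarrow> real) \<Rightarrow> nat \<Rightarrow> real" where
  "row_image A w j = (\<Sum>i<dim_row A. w i * A $$ (i,j))"

definition row_image_sq :: "real mat \<Rightarrow> (nat \<Rightarrow> real) \<Rightarrow> real" where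
  "row_image_sq A w = (\<Sum>j<dim_col A. (row_image A w j)\<^sup>2)"

definition gram_image_sq :: "real mat \<Rightarrow> (nat \<Rightarrow> real) \<Rightarrow> real" where
  "gram_image_sq A w = (\<Sum>i<dim_row A. (\<Sum>j<dim_col A. A $$ (i,j) * row_image A w j)\<^sup>2)"

abbreviation row_loss :: "nat \<Rightarrow> (nat \<Rightarrow> real) \<Rightarrow> real mat \<Rightarrow> real" where
  "row_loss n w \<equiv> SCW_loss 1 (mat 1 n (\<lambda>(i,j). w j))"

lemma row_image_sq_nonneg: "row_image_sq A w \<ge> 0"
  by (simp add: row_image_sq_def sum_nonneg)

lemma gram_image_sq_nonneg: "gram_image_sq A w \<ge> 0"
  by (simp add: gram_image_sq_def sum_nonneg)

lemma gram_image_sq_eq_0: "row_image_sq A w = 0 \<Longrightarrow> gram_image_sq A w = 0"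
  by (simp add: row_image_sq_def gram_image_sq_def sum_nonneg_eq_0_iff)

lemma row_times_mat:
  assumes "A \<in> carrier_mat n d" "j < d"
  shows "(mat 1 n (\<lambda>(i,j). w j) * A) $$ (0,j) = row_image A w j"
  using assms by (simp add: row_image_def scalar_prod_def atLeast0LessThan)

lemma row_times_mat_eq_0:
  assumes "A \<in> carrier_mat n d"
  shows "mat 1 n (\<lambda>(i,j). w j) * A = 0\<^sub>m 1 d \<longleftrightarrow> row_image_sq A w = 0"
proof
  assume *: "mat 1 n (\<lambda>(i,j). w j) * A = 0\<^sub>m 1 d"
  have "row_image A w j = 0" if "j < d" for j
    using row_times_mat[OF assms that, of w] that unfolding * by simp
  then show "row_image_sq A w = 0" using assms by (simp add: row_image_sq_def)
next
  assume "row_image_sq A w = 0"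
  then have "row_image A w j = 0" if "j < d" for j
    using assms that by (simp add: row_image_sq_def sum_nonneg_eq_0_iff)
  then show "mat 1 n (\<lambda>(i,j). w j) * A = 0\<^sub>m 1 d"
    using row_times_mat[OF assms, of _ w] assms by (intro eq_matI) (auto simp del: index_mult_mat(1))
qed

lemma row_loss_degenerate:
  assumes A: "A \<in> carrier_mat n d" and "row_image_sq A w = 0"
  shows "row_loss n w A = frob A"
proof -
  have "A - 0\<^sub>m n d = A" using A by (intro eq_matI) auto
  then show ?thesis
    using row_times_mat_eq_0[OF A, of w] assms by (simp add: SCW_loss_def SCW_def)
qed

text \<open>The output is \<open>A v v\<^sup>T\<close> with a unit vector \<open>v\<close> parallel
  to \<open>A\<^sup>T w\<close>: the rows of \<open>A\<close> are projected onto the line of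
  \<open>v\<close>. Pythagoras in each row gives \<open>|A|\<^sup>2 - |A v|\<^sup>2\<close>.\<close>

lemma row_loss_sq:
  assumes A: "A \<in> carrier_mat n d" and nz: "row_image_sq A w \<noteq> 0"
  shows "(row_loss n w A)\<^sup>2 = (frob A)\<^sup>2 - gram_image_sq A w / row_image_sq A w"
proof -
  define M where "M = mat 1 n (\<lambda>(i,j). w j) * A"
  have M: "M \<in> carrier_mat 1 d" "M \<noteq> 0\<^sub>m 1 d"
    using A row_times_mat_eq_0[OF A, of w] nz by (auto simp: M_def)
  define V where "V = (SOME V. \<exists>U Sig. thin_svd M U Sig V)"
  have "\<exists>U Sig. thin_svd M U Sig V"
    unfolding V_def using thin_svd_row_exists[OF M] by (metis (mono_tags, lifting) someI_ex)
  then obtain U Sig where svd: "thin_svd M U Sig V" by blast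
  obtain t where V: "V \<in> carrier_mat d 1" and unit: "(\<Sum>j<d. (V $$ (j,0))\<^sup>2) = 1"
    and Mt: "\<And>j. j < d \<Longrightarrow> M $$ (0,j) = t * V $$ (j,0)"
    using thin_svd_row[OF M svd] by blast
  have y: "row_image A w j = t * V $$ (j,0)" if "j < d" for j
    using Mt[OF that] row_times_mat[OF A that, of w] by (simp add: M_def)
  have rk: "rank_le (A * V) 1" using A V by (intro rank_le_one_col[of _ n]) auto
  have "best_rank_approx 1 (A * V) (SOME B. best_rank_approx 1 (A * V) B)"
    using best_rank_approx_selfI[OF rk] by (rule someI)
  then have "(SOME B. best_rank_approx 1 (A * V) B) = A * V"
    by (rule best_rank_approx_self[OF rk])
  then have scw: "SCW 1 (mat 1 n (\<lambda>(i,j). w j)) A = A * V * transpose_mat V"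
    using M A unfolding SCW_def M_def V_def by (simp add: Let_def)
  define v where "v j = V $$ (j,0)" for j
  define u where "u i = (\<Sum>j<d. A $$ (i,j) * v j)" for i
  have unit': "(\<Sum>j<d. (v j)\<^sup>2) = 1" using unit by (simp add: v_def)
  define R where "R = A - A * V * transpose_mat V"
  have R: "dim_row R = n" "dim_col R = d" using A V by (auto simp: R_def)
  have ent: "R $$ (i,j) = A $$ (i,j) - u i * v j"
    if "i < n" "j < d" for i j
    using that A V
    by (simp add: R_def u_def v_def scalar_prod_def atLeast0LessThan sum_distrib_right mult.assoc)
  have "(row_loss n w A)\<^sup>2 = (\<Sum>i<n. \<Sum>j<d. (A $$ (i,j) - u i * v j)\<^sup>2)"
    unfolding SCW_loss_def scw R_def[symmetric] frob_def
    by (subst real_sqrt_pow2) (auto intro!: sum_nonneg simp: R ent)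
  also have "\<dots> = (\<Sum>i<n. (\<Sum>j<d. (A $$ (i,j))\<^sup>2) - (u i)\<^sup>2)"
  proof (rule sum.cong)
    fix i
    have "(\<Sum>j<d. (A $$ (i,j) - u i * v j)\<^sup>2)
        = (\<Sum>j<d. (A $$ (i,j))\<^sup>2) - 2 * u i * (\<Sum>j<d. A $$ (i,j) * v j)
          + (u i)\<^sup>2 * (\<Sum>j<d. (v j)\<^sup>2)"
      by (simp add: power2_diff power_mult_distrib sum.distrib sum_subtractf sum_distrib_left ac_simps)
    also have "\<dots> = (\<Sum>j<d. (A $$ (i,j))\<^sup>2) - (u i)\<^sup>2"
      unfolding unit' u_def[symmetric] by (simp add: power2_eq_square)
    finally show "(\<Sum>j<d. (A $$ (i,j) - u i * v j)\<^sup>2) = (\<Sum>j<d. (A $$ (i,j))\<^sup>2) - (u i)\<^sup>2" .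
  qed simp
  also have "\<dots> = (frob A)\<^sup>2 - (\<Sum>i<n. (u i)\<^sup>2)"
    using A by (simp add: frob_def sum_subtractf sum_nonneg)
  also have "(\<Sum>i<n. (u i)\<^sup>2) = gram_image_sq A w / row_image_sq A w"
  proof -
    \<comment> \<open>Only the square of \<open>t\<close> enters the quotient, so the sign of the
      singular vector does not matter.\<close>
    have sq: "row_image_sq A w = t\<^sup>2"
      using A unit' by (simp add: row_image_sq_def y power_mult_distrib v_def flip: sum_distrib_left)
    have "(\<Sum>j<d. A $$ (i,j) * row_image A w j) = t * u i" for i
      by (simp add: y u_def v_def sum_distrib_left ac_simps)
    then have "gram_image_sq A w = t\<^sup>2 * (\<Sum>i<n. (u i)\<^sup>2)"
      using A by (simp add: gram_image_sq_def power_mult_distrib sum_distrib_left)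
    then show ?thesis using sq nz by simp
  qed
  finally show ?thesis .
qed

lemma row_loss_nonneg: "row_loss n w A \<ge> 0"
  by (simp add: SCW_loss_def frob_nonneg)

lemma row_loss_le_1:
  assumes "A \<in> unit_mats n d"
  shows "row_loss n w A \<le> 1"
proof (cases "row_image_sq A w = 0")
  case True
  then show ?thesis using assms row_loss_degenerate[of A n d w] by (auto simp: unit_mats_def)
next
  case False
  then have "(row_loss n w A)\<^sup>2 \<le> 1\<^sup>2"
    using assms row_loss_sq[of A n d w] gram_image_sq_nonneg row_image_sq_nonneg
    by (auto simp: unit_mats_def)
  then show ?thesis by (rule power2_le_imp_le) simp
qed

section \<open>Upper bound: shattering by losses reduces to quadratic polynomials\<close>

lemma poly_fun_row_image:
  assumes "A \<in> carrier_mat n d"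
  shows "poly_fun n 1 (\<lambda>w. row_image A w j)"
proof -
  have "poly_fun n 1 (\<lambda>w. \<Sum>i<n. A $$ (i,j) * w i)"
    by (intro poly_fun_sum poly_fun_cmult poly_fun_var) simp
  then show ?thesis using assms by (simp add: row_image_def mult.commute)
qed

lemma poly_fun_square: "poly_fun n 1 f \<Longrightarrow> poly_fun n 2 (\<lambda>w. (f w)\<^sup>2)"
  using poly_fun_mult[of n 1 f 1 f] by (simp add: power2_eq_square numeral_2_eq_2)

lemma poly_fun_row_image_sq:
  "A \<in> carrier_mat n d \<Longrightarrow> poly_fun n 2 (row_image_sq A)"
  unfolding row_image_sq_def by (intro poly_fun_sum poly_fun_square poly_fun_row_image)

lemma poly_fun_gram_image_sq:
  "A \<in> carrier_mat n d \<Longrightarrow> poly_fun n 2 (gram_image_sq A)"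
  unfolding gram_image_sq_def
  by (intro poly_fun_sum poly_fun_square poly_fun_cmult poly_fun_row_image)

text \<open>For a threshold \<open>r\<close>, the loss of \<open>w\<close> exceeds \<open>r\<close> iff the quadratic form
  \<open>(1 - r\<^sup>2) |A\<^sup>T w|\<^sup>2 - |A A\<^sup>T w|\<^sup>2\<close> is positive or \<open>A\<^sup>T w = 0\<close>. Only finitely many \<open>w\<close> matter, so
  slightly raising the threshold makes the form strictly negative where the loss stays below it, and adding a
  small constant \<open>\<eta>\<close> then makes it strictly positive at all other \<open>w\<close>, also where
  \<open>A\<^sup>T w = 0\<close>.\<close>
lemma pseudo_shatters_card_le:
  assumes n: "n \<ge> 1" and P: "finite P" "P \<subseteq> unit_mats n d" and sh: "pseudo_shatters (L1_class n) P"
  shows "card P \<le> 21 * n"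
proof -
  obtain r where r: "\<And>I. I \<subseteq> P \<Longrightarrow> \<exists>f\<in>L1_class n. \<forall>A\<in>P. f A > r A \<longleftrightarrow> A \<in> I"
    using sh unfolding pseudo_shatters_def by blast
  have "\<exists>w. \<forall>A\<in>P. row_loss n w A > r A \<longleftrightarrow> A \<in> I" if I: "I \<subseteq> P" for I
  proof -
    obtain v where v: "\<forall>A\<in>P. SCW_loss 1 (mat 1 n (\<lambda>(i,j). v $ j)) A > r A \<longleftrightarrow> A \<in> I"
      using r[OF I] unfolding L1_class_def by blast
    then show ?thesis by (intro exI[of _ "($) v"])
  qed
  then obtain W where W: "\<And>I A. I \<subseteq> P \<Longrightarrow> A \<in> P \<Longrightarrow> row_loss n (W I) A > r A \<longleftrightarrow> A \<in> I"
    by metis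
  have fin: "finite {I. I \<subseteq> P \<and> Q I}" for Q
    by (rule finite_subset[of _ "Pow P"]) (use P in auto)
  have "\<exists>r'. r A < r' \<and> (\<forall>I. I \<subseteq> P \<and> A \<in> I \<longrightarrow> r' < row_loss n (W I) A)" if A: "A \<in> P" for A
  proof -
    have "\<exists>r'>r A. \<forall>z\<in>(\<lambda>I. row_loss n (W I) A) ` {I. I \<subseteq> P \<and> A \<in> I}. r' < z"
      using A W by (intro finite_gap finite_imageI fin) auto
    then show ?thesis by auto
  qed
  then obtain r' where r': "\<And>A. A \<in> P \<Longrightarrow> r A < r' A"
    "\<And>A I. A \<in> P \<Longrightarrow> I \<subseteq> P \<Longrightarrow> A \<in> I \<Longrightarrow> r' A < row_loss n (W I) A"
    by metis
  have low: "row_loss n (W I) A < r' A" if "I \<subseteq> P" "A \<in> P - I" for I A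
    using W[OF that(1), of A] r'(1)[of A] that by auto
  \<comment> \<open>The pattern \<open>{}\<close> gives a loss below \<open>r' A\<close>, and below
    the pattern \<open>P\<close> gives one above it. This places \<open>r' A\<close> in
    \<open>[0, 1)\<close>, so comparisons survive squaring.\<close>
  have r'_nonneg: "r' A \<ge> 0" if "A \<in> P" for A
    using low[of "{}" A] row_loss_nonneg[of n "W {}" A] that by auto
  have r'_less: "r' A < 1" if "A \<in> P" for A
    using r'(2)[of A P] row_loss_le_1[of A n d "W P"] that P by (auto simp: subset_iff)
  define Q where "Q A w = (1 - (r' A)\<^sup>2) * row_image_sq A w - gram_image_sq A w" for A w
  have Q_eq: "Q A w = row_image_sq A w * ((row_loss n w A)\<^sup>2 - (r' A)\<^sup>2)"
    if "A \<in> P" "row_image_sq A w \<noteq> 0" for A w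
  proof -
    have "A \<in> carrier_mat n d" "frob A = 1" using that(1) P by (auto simp: unit_mats_def)
    then show ?thesis
      using row_loss_sq[of A n d w] that(2) by (simp add: Q_def field_simps)
  qed
  have Qpos: "Q A (W I) \<ge> 0" if I: "I \<subseteq> P" "A \<in> I" for I A
  proof (cases "row_image_sq A (W I) = 0")
    case True
    then show ?thesis by (simp add: Q_def gram_image_sq_eq_0)
  next
    case False
    have A: "A \<in> P" using I by auto
    have "(r' A)\<^sup>2 \<le> (row_loss n (W I) A)\<^sup>2"
      using r'(2)[OF A I] r'_nonneg[OF A] by (intro power_mono) auto
    then show ?thesis
      using Q_eq[OF A False] row_image_sq_nonneg[of A "W I"] by simp
  qed
  have Qneg: "Q A (W I) < 0" if I: "I \<subseteq> P" "A \<in> P - I" for I A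
  proof -
    have A: "A \<in> P" "A \<in> carrier_mat n d" "frob A = 1" using I P by (auto simp: unit_mats_def)
    \<comment> \<open>A vanishing sketch would have loss 1, which is above
      \<open>r' A\<close>.\<close>
    have nz: "row_image_sq A (W I) \<noteq> 0"
      using low[OF I] r'_less[OF A(1)] row_loss_degenerate[OF A(2), of "W I"] A(3) by auto
    have "(row_loss n (W I) A)\<^sup>2 < (r' A)\<^sup>2"
      using low[OF I] row_loss_nonneg by (intro power_strict_mono) auto
    then show ?thesis
      using Q_eq[OF A(1) nz] nz row_image_sq_nonneg[of A "W I"]
      by (simp add: mult_pos_neg)
  qed
  have "\<exists>\<eta>>0. \<forall>I. I \<subseteq> P \<and> A \<notin> I \<longrightarrow> \<eta> < - Q A (W I)" if A: "A \<in> P" for A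
  proof -
    have "\<exists>\<eta>>0. \<forall>z\<in>(\<lambda>I. - Q A (W I)) ` {I. I \<subseteq> P \<and> A \<notin> I}. \<eta> < z"
      using A Qneg by (intro finite_gap finite_imageI fin) auto
    then show ?thesis by auto
  qed
  then obtain \<eta> where \<eta>: "\<And>A. A \<in> P \<Longrightarrow> \<eta> A > 0"
    "\<And>A I. A \<in> P \<Longrightarrow> I \<subseteq> P \<Longrightarrow> A \<notin> I \<Longrightarrow> \<eta> A < - Q A (W I)"
    by metis
  show ?thesis
  proof (rule quadratic_sign_shattering[where p = "\<lambda>A w. Q A w + \<eta> A" and w = W])
    fix A assume "A \<in> P"
    then have "A \<in> carrier_mat n d" using P by (auto simp: unit_mats_def)
    then show "poly_fun n 2 (\<lambda>w. Q A w + \<eta> A)"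
      unfolding Q_def
      by (intro poly_fun_add poly_fun_diff poly_fun_cmult poly_fun_const
          poly_fun_row_image_sq poly_fun_gram_image_sq)
  next
    fix I A assume I: "I \<subseteq> P" "A \<in> I"
    then show "Q A (W I) + \<eta> A > 0" using Qpos[OF I] \<eta>(1)[of A] by auto
  next
    fix I A assume "I \<subseteq> P" "A \<in> P - I"
    then show "Q A (W I) + \<eta> A < 0" using \<eta>(2)[of A I] by auto
  qed (use P n in auto)
qed

section \<open>Lower bound: matrices with a single nonzero entry\<close>

definition first_col_unit :: "nat \<Rightarrow> nat \<Rightarrow> nat \<Rightarrow> real mat" where
  "first_col_unit n d i = mat n d (\<lambda>(a,b). if a = i \<and> b = 0 then 1 else 0)"

lemma first_col_unit_in_unit_mats:
  assumes "i < n" "1 \<le> d"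
  shows "first_col_unit n d i \<in> unit_mats n d"
proof -
  have "(\<Sum>a<n. \<Sum>b<d. (first_col_unit n d i $$ (a,b))\<^sup>2) = (\<Sum>a<n. \<Sum>b<d. if b = 0 then if a = i then 1 else 0 else 0)"
    by (intro sum.cong) (auto simp: first_col_unit_def)
  also have "\<dots> = 1" using assms by (simp add: sum.delta)
  finally show ?thesis by (simp add: unit_mats_def frob_def first_col_unit_def)
qed

text \<open>\<open>A\<^sup>T w\<close> is \<open>w i\<close> times the first unit vector. If
  \<open>w i\<close> is nonzero, projecting onto that vector reproduces the matrix; otherwise
  \<open>SCW\<close> returns its default 0.\<close>

lemma row_loss_first_col_unit:
  assumes i: "i < n" and d: "1 \<le> d"
  shows "row_loss n w (first_col_unit n d i) = (if w i = 0 then 1 else 0)"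
proof -
  let ?A = "first_col_unit n d i"
  have A: "?A \<in> carrier_mat n d" "frob ?A = 1"
    using first_col_unit_in_unit_mats[OF assms] by (auto simp: unit_mats_def)
  have ent: "?A $$ (a,b) = (if a = i \<and> b = 0 then 1 else 0)" if "a < n" "b < d" for a b
    using that by (simp add: first_col_unit_def)
  have y: "row_image ?A w j = (if j = 0 then w i else 0)" if "j < d" for j
  proof -
    have "row_image ?A w j = (\<Sum>a<n. if a = i then if j = 0 then w i else 0 else 0)"
      unfolding row_image_def using that by (intro sum.cong) (auto simp: first_col_unit_def)
    then show ?thesis using i by (simp add: sum.delta)
  qed
  have "row_image_sq ?A w = (\<Sum>j<d. if j = 0 then (w i)\<^sup>2 else 0)"
    unfolding row_image_sq_def using A(1) by (intro sum.cong) (auto simp: y)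
  then have sq: "row_image_sq ?A w = (w i)\<^sup>2" using d by (simp add: sum.delta)
  have "gram_image_sq ?A w = (\<Sum>a<n. (\<Sum>j<d. if j = 0 then if a = i then w i else 0 else 0)\<^sup>2)"
    unfolding gram_image_sq_def
    using A(1) by (intro sum.cong arg_cong[of _ _ "\<lambda>x. x\<^sup>2"]) (auto simp: y ent)
  also have "\<dots> = (\<Sum>a<n. if a = i then (w i)\<^sup>2 else 0)"
    using d by (intro sum.cong) (auto simp: sum.delta)
  finally have gram: "gram_image_sq ?A w = (w i)\<^sup>2" using i by (simp add: sum.delta)
  show ?thesis
  proof (cases "w i = 0")
    case True
    then show ?thesis using row_loss_degenerate[OF A(1), of w] A(2) sq by simp
  next
    case False
    then have "(row_loss n w ?A)\<^sup>2 = 0" using row_loss_sq[OF A(1), of w] A(2) sq gram by simp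
    then show ?thesis using False by simp
  qed
qed

lemma fat_shatters_first_col_unit:
  assumes d: "1 \<le> d" and \<epsilon>: "\<epsilon> < 1/2"
  shows "fat_shatters \<epsilon> (L1_class n) (first_col_unit n d ` {..<n})"
  unfolding fat_shatters_def
proof (intro exI[of _ "\<lambda>_. 1/2"] allI impI)
  fix I assume I: "I \<subseteq> first_col_unit n d ` {..<n}"
  \<comment> \<open>Zero coordinates produce loss 1, so they mark the members of \<open>I\<close>.
    The losses 0 and 1 lie at distance 1/2 from the threshold, hence any margin below 1/2
    works.\<close>
  define w where "w = vec n (\<lambda>i. if first_col_unit n d i \<in> I then 0 else 1 :: real)"
  define f where "f = SCW_loss 1 (mat 1 n (\<lambda>(i,j). w $ j))"
  have "f \<in> L1_class n" unfolding L1_class_def f_def by (auto simp: w_def)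
  moreover have "f (first_col_unit n d i) = (if first_col_unit n d i \<in> I then 1 else 0)" if "i < n" for i
    unfolding f_def using row_loss_first_col_unit[OF that d, of "($) w"] that by (simp add: w_def)
  then have "(\<forall>x\<in>I. f x > 1/2 + \<epsilon>) \<and> (\<forall>x\<in>first_col_unit n d ` {..<n} - I. f x < 1/2 - \<epsilon>)"
    using I \<epsilon> by auto
  ultimately show "\<exists>f\<in>L1_class n. (\<forall>x\<in>I. f x > 1/2 + \<epsilon>) \<and>
      (\<forall>x\<in>first_col_unit n d ` {..<n} - I. f x < 1/2 - \<epsilon>)" by blast
qed

lemma card_first_col_unit: "1 \<le> d \<Longrightarrow> card (first_col_unit n d ` {..<n}) = n"
proof -
  assume d: "1 \<le> d"
  have "inj_on (first_col_unit n d) {..<n}"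
  proof (rule inj_onI)
    fix i j assume ij: "i \<in> {..<n}" "j \<in> {..<n}" and eq: "first_col_unit n d i = first_col_unit n d j"
    have "first_col_unit n d i $$ (i,0) = first_col_unit n d j $$ (i,0)" by (simp only: eq)
    then show "i = j" using ij d by (simp add: first_col_unit_def split: if_splits)
  qed
  then show ?thesis by (simp add: card_image)
qed

section \<open>From shattered sets to dimensions\<close>

lemma fat_imp_pseudo_shatters:
  assumes "0 < \<gamma>" "fat_shatters \<gamma> F P"
  shows "pseudo_shatters F P"
proof -
  obtain r where r: "\<And>I. I \<subseteq> P \<Longrightarrow>
      \<exists>f\<in>F. (\<forall>x\<in>I. f x > r x + \<gamma>) \<and> (\<forall>x\<in>P - I. f x < r x - \<gamma>)"
    using assms(2) unfolding fat_shatters_def by blast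
  have "\<exists>f\<in>F. \<forall>x\<in>P. f x > r x \<longleftrightarrow> x \<in> I" if "I \<subseteq> P" for I
    using r[OF that] assms(1) by (smt (verit) DiffI)
  then show ?thesis unfolding pseudo_shatters_def by blast
qed

text \<open>Serves both dimensions. The uniform bound rules out an infinite supremum, on which
  \<open>the_enat\<close> is unspecified.\<close>

lemma Sup_card_bounds:
  assumes "\<And>P. P \<in> \<P> \<Longrightarrow> card P \<le> u" "P\<^sub>0 \<in> \<P>"
  shows "Sup ((\<lambda>P. enat (card P)) ` \<P>) \<noteq> \<infinity> \<and>
    card P\<^sub>0 \<le> the_enat (Sup ((\<lambda>P. enat (card P)) ` \<P>)) \<and>
    the_enat (Sup ((\<lambda>P. enat (card P)) ` \<P>)) \<le> u"
proof -
  have "Sup ((\<lambda>P. enat (card P)) ` \<P>) \<le> enat u" by (rule SUP_least) (simp add: assms(1))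
  moreover have "enat (card P\<^sub>0) \<le> Sup ((\<lambda>P. enat (card P)) ` \<P>)" by (rule SUP_upper) (rule assms(2))
  ultimately show ?thesis by (cases "Sup ((\<lambda>P. enat (card P)) ` \<P>)") auto
qed

theorem theorem4p2:
  "\<exists>c1 c2 :: real. c1 > 0 \<and> c2 > 0 \<and>
     (\<forall>n d. 1 \<le> d \<longrightarrow> d \<le> n \<longrightarrow>
        (pdim (unit_mats n d) (L1_class n) \<noteq> \<infinity> \<and>
         c1 * real n \<le> real (the_enat (pdim (unit_mats n d) (L1_class n))) \<and>
         real (the_enat (pdim (unit_mats n d) (L1_class n))) \<le> c2 * real n) \<and>
        (\<forall>\<epsilon>::real. 0 < \<epsilon> \<longrightarrow> \<epsilon> < 1/2 \<longrightarrow>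
           fatdim \<epsilon> (unit_mats n d) (L1_class n) \<noteq> \<infinity> \<and>
           c1 * real n \<le> real (the_enat (fatdim \<epsilon> (unit_mats n d) (L1_class n))) \<and>
           real (the_enat (fatdim \<epsilon> (unit_mats n d) (L1_class n))) \<le> c2 * real n))"
proof (rule exI[of _ 1], rule exI[of _ 21], intro conjI[of "(0::real) < _"] allI impI)
  fix n d :: nat assume d: "1 \<le> d" and dn: "d \<le> n"
  let ?X = "unit_mats n d" and ?F = "L1_class n" and ?P = "first_col_unit n d ` {..<n}"
  have sub: "finite ?P" "?P \<subseteq> ?X" using first_col_unit_in_unit_mats d by auto
  have upper: "card P \<le> 21 * n" if "finite P" "P \<subseteq> ?X" "pseudo_shatters ?F P" for P
    using pseudo_shatters_card_le[OF _ that] d dn by simp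
  have "pseudo_shatters ?F ?P"
    \<comment> \<open>Any margin strictly between 0 and 1/2 would do.\<close>
    by (rule fat_imp_pseudo_shatters[of "1/4"]) (auto intro: fat_shatters_first_col_unit[OF d])
  then have 1: "pdim ?X ?F \<noteq> \<infinity> \<and> n \<le> the_enat (pdim ?X ?F) \<and> the_enat (pdim ?X ?F) \<le> 21 * n"
    unfolding pdim_def
    using Sup_card_bounds[of "{P. finite P \<and> P \<subseteq> ?X \<and> pseudo_shatters ?F P}" "21 * n" ?P]
      upper sub card_first_col_unit[OF d, of n] by simp
  have 2: "fatdim \<epsilon> ?X ?F \<noteq> \<infinity> \<and> n \<le> the_enat (fatdim \<epsilon> ?X ?F) \<and> the_enat (fatdim \<epsilon> ?X ?F) \<le> 21 * n"
    if "0 < \<epsilon>" "\<epsilon> < 1/2" for \<epsilon> :: real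
    unfolding fatdim_def
    using Sup_card_bounds[of "{P. finite P \<and> P \<subseteq> ?X \<and> fat_shatters \<epsilon> ?F P}" "21 * n" ?P]
      upper[OF _ _ fat_imp_pseudo_shatters[OF that(1)]] sub card_first_col_unit[OF d, of n]
      fat_shatters_first_col_unit[OF d that(2), of n] by simp
  have real_bounds: "1 * real n \<le> real k \<and> real k \<le> 21 * real n" if "n \<le> k" "k \<le> 21 * n" for k
    using that by linarith
  show "(pdim ?X ?F \<noteq> \<infinity> \<and>
         1 * real n \<le> real (the_enat (pdim ?X ?F)) \<and>
         real (the_enat (pdim ?X ?F)) \<le> 21 * real n) \<and>
        (\<forall>\<epsilon>::real. 0 < \<epsilon> \<longrightarrow> \<epsilon> < 1/2 \<longrightarrow>
           fatdim \<epsilon> ?X ?F \<noteq> \<infinity> \<and>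
           1 * real n \<le> real (the_enat (fatdim \<epsilon> ?X ?F)) \<and>
           real (the_enat (fatdim \<epsilon> ?X ?F)) \<le> 21 * real n)"
    using 1 2 real_bounds by blast
qed simp_all

end
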